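(* Let $f\in\mathcal{S}(L,m)$ with unique minimizer $x^\star$, let $m'\in[m,L]$ and $\kappa=L/m$. If $y_t$ are generated by Nesterov's accelerated gradient method (NAG) parameterized with $m'$ instead of $m$, that is, $x_0=y_0\in\mathbb{R}^d$ and for all $t\ge0$ $$y_{t+1}=x_t-\frac1L\nabla f(x_t),\qquad x_{t+1}=y_{t+1}+\frac{\sqrt L-\sqrt{m'}}{\sqrt L+\sqrt{m'}}\,(y_{t+1}-y_t),$$ then for all $t\ge 0$ $$f(y_{t+1})-f(x^\star)\le\Bigl(1-\frac1\kappa\Bigr)^t\,2L\kappa^2\,\Vert x_0-x^\star\Vert^2 .$$
   Context: $\Vert\cdot\Vert$ is the Euclidean norm. A differentiable $f:\mathbb{R}^d\to\mathbb{R}$ belongs to $\mathcal{S}(L,m)$, with $L>0$ and $m>0$, if for all $x,y\in\mathbb{R}^d$ $$f(x)+\langle\nabla f(x),y-x\rangle+\tfrac m2\Vert y-x\Vert^2\le f(y)\le f(x)+\langle\nabla f(x),y-x\rangle+\tfrac L2\Vert y-x\Vert^2 .$$ *)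

theory Defs
  imports "HOL-Analysis.Analysis"
begin

text \<open>Meaningful only where \<^term>\<open>f\<close> is differentiable; the lemmas below show that the
  description then denotes the unique gradient vector.\<close>

definition grad :: "('a::euclidean_space \<Rightarrow> real) \<Rightarrow> 'a \<Rightarrow> 'a" where
  "grad f x = (THE D. GDERIV f x :> D)"

lemma grad_eqI:
  assumes "GDERIV f x :> D"
  shows "grad f x = D"
  unfolding grad_def
proof (rule the_equality)
  fix E assume "GDERIV f x :> E"
  with assms have "(\<lambda>h. h \<bullet> E) = (\<lambda>h. h \<bullet> D)"
    unfolding gderiv_def using has_derivative_unique by blast
  then have "h \<bullet> E = h \<bullet> D" for h by meson
  then show "E = D" by (metis vector_eq_ldot)
qed (fact assms)

lemma GDERIV_grad:
  fixes f :: "'a::euclidean_space \<Rightarrow> real"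
  assumes "f differentiable (at x)"
  shows "GDERIV f x :> grad f x"
proof -
  obtain f' where f': "(f has_derivative f') (at x)"
    using assms unfolding differentiable_def by blast
  then have "linear f'"
    by (rule has_derivative_linear)
  then have "f' h = h \<bullet> adjoint f' 1" for h
    using adjoint_works[of f' h 1] by simp
  then have "f' = (\<lambda>h. h \<bullet> adjoint f' 1)" by blast
  with f' have "GDERIV f x :> adjoint f' 1"
    unfolding gderiv_def by metis
  then show ?thesis using grad_eqI by metis
qed

definition smooth_strongly_convex :: "real \<Rightarrow> real \<Rightarrow> ('a::euclidean_space \<Rightarrow> real) set" where
  "smooth_strongly_convex L m = {f.
     (\<forall>x. f differentiable (at x)) \<and>
     (\<forall>x y. f x + grad f x \<bullet> (y - x) + m / 2 * (norm (y - x))\<^sup>2 \<le> f y \<and>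
            f y \<le> f x + grad f x \<bullet> (y - x) + L / 2 * (norm (y - x))\<^sup>2)}"

definition unique_minimizer :: "('a \<Rightarrow> real) \<Rightarrow> 'a \<Rightarrow> bool" where
  "unique_minimizer f z \<longleftrightarrow> (\<forall>w. is_arg_min f (\<lambda>_. True) w \<longleftrightarrow> w = z)"

definition NAG :: "real \<Rightarrow> real \<Rightarrow> ('a::euclidean_space \<Rightarrow> real) \<Rightarrow> (nat \<Rightarrow> 'a) \<Rightarrow> (nat \<Rightarrow> 'a) \<Rightarrow> bool" where
  "NAG L \<mu> f x y \<longleftrightarrow>
     x 0 = y 0 \<and>
     (\<forall>t. y (Suc t) = x t - (1 / L) *\<^sub>R grad f (x t) \<and>
          x (Suc t) = y (Suc t) +
            ((sqrt L - sqrt \<mu>) / (sqrt L + sqrt \<mu>)) *\<^sub>R (y (Suc t) - y t))"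

end

theory Submission
  imports Defs
begin

text \<open>Put \<open>q = m / L\<close>, let \<open>\<beta>\<close> be the momentum coefficient, and measure all points from the
  minimizer. The Lyapunov function
  \<open>V t = f (y t) - f x_star + L / 2 * (norm (y t - (1 - q) *\<^sub>R y (t - 1)))\<^sup>2\<close>
  contracts by the factor \<open>1 - q\<close> in every step. To see this, average the descent inequality at
  \<open>y t\<close> (weight \<open>1 - q\<close>) and at \<open>x_star\<close> (weight \<open>q\<close>) and complete the square; what remains is a
  quadratic inequality in \<open>y t\<close> and \<open>y (t - 1)\<close>. It holds as soon as \<open>0 \<le> \<beta> \<le> 1 - q\<close>, and this is
  where \<open>m \<le> m' \<le> L\<close> enters.\<close>

text \<open>The step \<open>1 / L\<close> minimizes the quadratic upper model at \<open>x\<close>,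
  which gives the decrease \<open>(norm (grad f x))\<^sup>2 / (2 * L)\<close>; the strong convexity
  lower bound then trades \<open>f x\<close> for \<open>f z\<close>.\<close>

lemma gradient_step_descent:
  fixes f :: "'a::euclidean_space \<Rightarrow> real"
  assumes f: "f \<in> smooth_strongly_convex L m" and L: "L > 0"
  shows "f (x - (1 / L) *\<^sub>R grad f x)
    \<le> f z + grad f x \<bullet> (x - z) - (norm (grad f x))\<^sup>2 / (2 * L) - m / 2 * (norm (x - z))\<^sup>2"
proof -
  let ?g = "grad f x" and ?y = "x - (1 / L) *\<^sub>R grad f x"
  have "f ?y \<le> f x + ?g \<bullet> (?y - x) + L / 2 * (norm (?y - x))\<^sup>2"
    and lower: "f x + ?g \<bullet> (z - x) + m / 2 * (norm (z - x))\<^sup>2 \<le> f z"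
    using f unfolding smooth_strongly_convex_def by blast+
  moreover have "?g \<bullet> (?y - x) + L / 2 * (norm (?y - x))\<^sup>2 = - (norm ?g)\<^sup>2 / (2 * L)"
    using L by (simp add: dot_square_norm power2_eq_square field_simps)
  moreover have "?g \<bullet> (z - x) = - (?g \<bullet> (x - z))" "norm (z - x) = norm (x - z)"
    by (simp_all add: inner_diff_right norm_minus_commute)
  ultimately show ?thesis by auto
qed

lemma grad_minimizer_eq_0:
  fixes f :: "'a::euclidean_space \<Rightarrow> real"
  assumes f: "f \<in> smooth_strongly_convex L m" and L: "L > 0" and min: "\<And>w. f z \<le> f w"
  shows "grad f z = 0"
proof -
  have "(norm (grad f z))\<^sup>2 / (2 * L) \<le> 0"
    using gradient_step_descent[OF f L, of z z] min[of "z - (1 / L) *\<^sub>R grad f z"] by simp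
  with L show ?thesis by (simp add: divide_le_0_iff)
qed

lemma gradient_step_averaged:
  fixes f :: "'a::euclidean_space \<Rightarrow> real"
  assumes f: "f \<in> smooth_strongly_convex L m" and L: "L > 0"
    and q: "q = m / L" "0 \<le> q" "q \<le> 1"
    and y': "y' = x - (1 / L) *\<^sub>R grad f x"
  shows "f y' - f z + L / 2 * (norm (y' - z - (1 - q) *\<^sub>R (y - z)))\<^sup>2
    \<le> (1 - q) * (f y - f z) + L / 2 * ((norm (x - z - (1 - q) *\<^sub>R (y - z)))\<^sup>2
       - q\<^sup>2 * (norm (x - z))\<^sup>2 - (1 - q) * q * (norm (x - y))\<^sup>2)"
proof -
  define G where "G = (1 / L) *\<^sub>R grad f x"
  have g: "grad f x = L *\<^sub>R G" and m: "m = L * q" using L q by (simp_all add: G_def)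
  \<comment> \<open>\<open>D v\<close> is the descent bound for \<open>f y' - f v\<close>, rescaled
    so that \<open>y' = x - G\<close>.\<close>
  define D where "D = (\<lambda>v. L * (G \<bullet> (x - v)) - L / 2 * (G \<bullet> G)
    - L / 2 * q * ((x - v) \<bullet> (x - v)))"
  have D: "f y' \<le> f v + D v" for v
    using gradient_step_descent[OF f L, of x v] L unfolding y' D_def
    by (simp add: g m power_mult_distrib power2_norm_eq_inner)
       (simp add: field_simps power2_eq_square)
  have "(1 - q) * f y' + q * f y' \<le> (1 - q) * (f y + D y) + q * (f z + D z)"
    using q D by (intro add_mono mult_left_mono) auto
  \<comment> \<open>The averaged terms linear in \<open>G\<close> pair it with
    \<open>(1 - q) *\<^sub>R (x - y) + q *\<^sub>R (x - z)\<close>, which is exactly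
    \<open>x - z - (1 - q) *\<^sub>R (y - z)\<close>; hence the square closes.\<close>
  moreover have "L / 2 * (norm (y' - z - (1 - q) *\<^sub>R (y - z)))\<^sup>2 + ((1 - q) * D y + q * D z)
    = L / 2 * ((norm (x - z - (1 - q) *\<^sub>R (y - z)))\<^sup>2
       - q\<^sup>2 * (norm (x - z))\<^sup>2 - (1 - q) * q * (norm (x - y))\<^sup>2)"
  proof -
    define X Y where "X = x - z" and "Y = y - z"
    have "y' - z - (1 - q) *\<^sub>R (y - z) = X - G - (1 - q) *\<^sub>R Y" "x - y = X - Y"
      by (simp_all add: y' G_def X_def Y_def)
    then show ?thesis
      unfolding D_def power2_norm_eq_inner X_def[symmetric] Y_def[symmetric]
      by (simp add: inner_simps inner_commute power2_eq_square) (simp add: inner_commute field_simps)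
  qed
  ultimately show ?thesis by (simp add: algebra_simps)
qed

text \<open>The gap between the two sides is an explicit combination of squares whose coefficients
  are nonnegative because \<open>\<beta> / (1 - q)\<close> lies in the unit interval. Here
  \<open>y\<close> and \<open>u\<close> stand for the current and the previous iterate.\<close>

lemma momentum_quadratic_bound:
  fixes y u :: "'a::real_inner"
  assumes q: "0 \<le> q" "q \<le> 1" and \<beta>: "0 \<le> \<beta>" "\<beta> \<le> 1 - q"
    and x: "x = y + \<beta> *\<^sub>R (y - u)"
  shows "(norm (x - (1 - q) *\<^sub>R y))\<^sup>2 - q\<^sup>2 * (norm x)\<^sup>2 - (1 - q) * q * (norm (x - y))\<^sup>2
    \<le> (1 - q) * (norm (y - (1 - q) *\<^sub>R u))\<^sup>2"
proof -
  define w where "w = y - (1 - q) *\<^sub>R u"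
  \<comment> \<open>If \<open>q = 1\<close>, then \<open>\<beta> = 0\<close> and the division by zero yields \<open>b = 0\<close>.\<close>
  define b where "b = \<beta> / (1 - q)"
  have b: "\<beta> = b * (1 - q)" "0 \<le> b" "b \<le> 1"
    using q \<beta> by (auto simp: b_def divide_le_eq_1)
  \<comment> \<open>This eliminates \<open>u\<close>, since
    \<open>w - q *\<^sub>R y = (1 - q) *\<^sub>R (y - u)\<close>.\<close>
  have "x = y + b *\<^sub>R (w - q *\<^sub>R y)"
    by (simp add: x b w_def algebra_simps)
  then have "(1 - q) * (norm w)\<^sup>2
      - ((norm (x - (1 - q) *\<^sub>R y))\<^sup>2 - q\<^sup>2 * (norm x)\<^sup>2 - (1 - q) * q * (norm (x - y))\<^sup>2)
    = (1 - q) * (b * q\<^sup>2 * (norm y)\<^sup>2 + (1 - b) * (norm w)\<^sup>2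
      + b * (1 - b) * (norm (q *\<^sub>R y - w))\<^sup>2)"
    unfolding power2_norm_eq_inner
    by (simp add: inner_simps inner_commute power2_eq_square) (simp add: inner_commute algebra_simps)
  also have "\<dots> \<ge> 0" using q b by (intro mult_nonneg_nonneg add_nonneg_nonneg) auto
  finally show ?thesis by (simp add: w_def)
qed

lemma momentum_coefficient_bounds:
  fixes L m m' :: real
  assumes "0 < m" "m \<le> m'" "m' \<le> L"
  shows "0 \<le> (sqrt L - sqrt m') / (sqrt L + sqrt m')"
    and "(sqrt L - sqrt m') / (sqrt L + sqrt m') \<le> 1 - m / L"
proof -
  define a c where "a = sqrt L" and "c = sqrt m'"
  have ac: "0 < c" "c \<le> a" "L = a\<^sup>2" "m' = c\<^sup>2"
    using assms by (auto simp: a_def c_def)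
  then show "0 \<le> (sqrt L - sqrt m') / (sqrt L + sqrt m')"
    by (simp flip: a_def c_def)
  \<comment> \<open>Factoring \<open>1 - c\<^sup>2 / a\<^sup>2\<close> as
    \<open>(a - c) * (a + c) / a\<^sup>2\<close> reduces the upper bound to
    \<open>a \<le> a + c\<close>.\<close>
  have "(a - c) * a\<^sup>2 \<le> (a - c) * (a + c)\<^sup>2"
    using ac by (intro mult_left_mono power_mono) auto
  then have "(a - c) / (a + c) \<le> 1 - c\<^sup>2 / a\<^sup>2"
    using ac by (simp add: field_simps power2_eq_square)
  also have "\<dots> \<le> 1 - m / L"
    using assms ac by (simp add: divide_right_mono)
  finally show "(sqrt L - sqrt m') / (sqrt L + sqrt m') \<le> 1 - m / L"
    by (simp add: a_def c_def)
qed

lemma NAG_lyapunov_bound: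
  fixes f :: "'a::euclidean_space \<Rightarrow> real"
  assumes f: "f \<in> smooth_strongly_convex L m" and m: "0 < m" "m \<le> m'" "m' \<le> L"
    and min: "\<And>w. f z \<le> f w" and nag: "NAG L m' f x y"
    and q: "q = m / L"
  shows "f (y (Suc t)) - f z + L / 2 * (norm (y (Suc t) - z - (1 - q) *\<^sub>R (y t - z)))\<^sup>2
    \<le> (1 - q) ^ Suc t * (L / 2 * (norm (x 0 - z))\<^sup>2)"
proof -
  have L: "L > 0" using m by simp
  have q01: "0 \<le> q" "q \<le> 1" using m L by (auto simp: q divide_le_eq_1)
  define \<beta> where "\<beta> = (sqrt L - sqrt m') / (sqrt L + sqrt m')"
  have \<beta>: "0 \<le> \<beta>" "\<beta> \<le> 1 - q"
    using momentum_coefficient_bounds[OF m] by (simp_all add: \<beta>_def q)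
  have y0: "x 0 = y 0" and y: "\<And>t. y (Suc t) = x t - (1 / L) *\<^sub>R grad f (x t)"
    and x: "\<And>t. x (Suc t) = y (Suc t) + \<beta> *\<^sub>R (y (Suc t) - y t)"
    using nag by (auto simp: NAG_def \<beta>_def)
  note step = gradient_step_averaged[OF f L q q01 y, where z = z]
  show ?thesis
  proof (induction t)
    case 0
    have "f (x 0) - f z \<le> L / 2 * (norm (x 0 - z))\<^sup>2"
    proof -
      have "f (x 0) \<le> f z + grad f z \<bullet> (x 0 - z) + L / 2 * (norm (x 0 - z))\<^sup>2"
        using f unfolding smooth_strongly_convex_def by blast
      then show ?thesis by (simp add: grad_minimizer_eq_0[OF f L min])
    qed
    then have "(1 - q) * (f (x 0) - f z) \<le> (1 - q) * (L / 2 * (norm (x 0 - z))\<^sup>2)"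
      using q01 by (intro mult_left_mono) auto
    \<comment> \<open>As \<open>x 0 = y 0\<close>, the square in the averaged bound is cancelled by
      its \<open>q\<^sup>2\<close> term, so the first step needs no earlier iterate.\<close>
    moreover have "x 0 - z - (1 - q) *\<^sub>R (x 0 - z) = q *\<^sub>R (x 0 - z)"
      by (simp add: algebra_simps)
    ultimately show ?case
      using step[of 0 "y 0"] by (simp add: y0 power_mult_distrib)
  next
    case (Suc t)
    let ?V = "\<lambda>t. f (y (Suc t)) - f z + L / 2 * (norm (y (Suc t) - z - (1 - q) *\<^sub>R (y t - z)))\<^sup>2"
    \<comment> \<open>The momentum update commutes with translation, so the quadratic bound applies
      to points measured from \<open>z\<close>.\<close>
    have "x (Suc t) - z = (y (Suc t) - z) + \<beta> *\<^sub>R ((y (Suc t) - z) - (y t - z))"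
      by (simp add: x)
    from momentum_quadratic_bound[OF q01 \<beta> this]
    have "L / 2 * ((norm (x (Suc t) - z - (1 - q) *\<^sub>R (y (Suc t) - z)))\<^sup>2
        - q\<^sup>2 * (norm (x (Suc t) - z))\<^sup>2 - (1 - q) * q * (norm (x (Suc t) - y (Suc t)))\<^sup>2)
      \<le> L / 2 * ((1 - q) * (norm (y (Suc t) - z - (1 - q) *\<^sub>R (y t - z)))\<^sup>2)"
      using L by (intro mult_left_mono) auto
    with step[of "Suc t" "y (Suc t)"] have "?V (Suc t) \<le> (1 - q) * ?V t"
      by (simp only: distrib_left mult.left_commute[of "1 - q" "L / 2"])
    also have "\<dots> \<le> (1 - q) * ((1 - q) ^ Suc t * (L / 2 * (norm (x 0 - z))\<^sup>2))"
      using Suc.IH q01 by (intro mult_left_mono) auto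
    finally show ?case by (simp add: mult.assoc)
  qed
qed

theorem corollary4p1:
  fixes f :: "real ^ 'd \<Rightarrow> real"
    and x y :: "nat \<Rightarrow> real ^ 'd"
    and x_star :: "real ^ 'd"
    and L m m' \<kappa> :: real
  assumes "L > 0" and "m > 0"
    and "f \<in> smooth_strongly_convex L m"
    and "unique_minimizer f x_star"
    and "m' \<in> {m..L}"
    and "\<kappa> = L / m"
    and "NAG L m' f x y"
  shows "\<forall>t. f (y (t + 1)) - f x_star
           \<le> (1 - 1 / \<kappa>) ^ t * (2 * L * \<kappa>\<^sup>2) * (norm (x 0 - x_star))\<^sup>2"
proof
  fix t
  define q where "q = m / L"
  have q: "0 \<le> q" "q \<le> 1" "1 / \<kappa> = q" "1 \<le> \<kappa>"
    using assms by (auto simp: q_def divide_le_eq_1 le_divide_eq_1)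
  have min: "f x_star \<le> f w" for w
    using assms(4) by (auto simp: unique_minimizer_def is_arg_min_def not_less)
  have "f (y (Suc t)) - f x_star
      \<le> f (y (Suc t)) - f x_star
        + L / 2 * (norm (y (Suc t) - x_star - (1 - q) *\<^sub>R (y t - x_star)))\<^sup>2"
    using assms(1) by simp
  also have "\<dots> \<le> (1 - q) ^ Suc t * (L / 2 * (norm (x 0 - x_star))\<^sup>2)"
    using assms by (intro NAG_lyapunov_bound[OF assms(3) _ _ _ min assms(7) q_def]) auto
  \<comment> \<open>One factor \<open>1 - q \<le> 1\<close> is given up, and
    \<open>1 \<le> \<kappa>\<close> absorbs the change of constant.\<close>
  also have "\<dots> \<le> (1 - q) ^ t * (2 * L * \<kappa>\<^sup>2 * (norm (x 0 - x_star))\<^sup>2)"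
  proof (rule mult_mono[OF power_decreasing mult_right_mono])
    have "L / 2 * 1 \<le> 2 * L * \<kappa>\<^sup>2"
      using assms(1) q by (intro mult_mono) auto
    then show "L / 2 \<le> 2 * L * \<kappa>\<^sup>2" by simp
  qed (use q assms(1) in auto)
  finally show "f (y (t + 1)) - f x_star
      \<le> (1 - 1 / \<kappa>) ^ t * (2 * L * \<kappa>\<^sup>2) * (norm (x 0 - x_star))\<^sup>2"
    by (simp add: q(3) mult.assoc)
qed

end
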